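(* Let $p\ge2$ be an integer. The growth rate of the group $F(p)$ with respect to the generators $x_0,x_1,\dots,x_{p-1}$ is at least $\xi_p$, where $\xi_p$ is the real number $\xi>1$ satisfying the equation $$(2\xi-1)(\xi-1)^{p-1}=\xi^p.$$ Moreover, the following asymptotic formula holds: $$\xi_p=\frac{p-\frac12}{\ln 2}+\frac12+o(1),\qquad p\to\infty.$$
   Context: For an integer $p\ge2$, the generalized Thompson group $F(p)$ is the group given by the presentation $\langle x_i\ (i\ge0)\mid x_jx_i=x_ix_{j+p-1}\ (0\le i<j)\rangle$. It is generated by $x_0,x_1,\dots,x_{p-1}$. Let $\gamma_n$ be the number of elements of $F(p)$ of word length at most $n$ with respect to the generating set $\{x_0,\dots,x_{p-1}\}$ (inverses allowed). The growth rate of $F(p)$ is $\lim_{n\to\infty}\gamma_n^{1/n}$ (the limit exists by submultiplicativity of $\gamma_n$). For each $p\ge 2$ the equation above has exactly one real root greater than $1$. *)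

theory Defs
  imports Complex_Main "HOL-Algebra.Group" "HOL-Library.Landau_Symbols" "HOL-Library.Extended_Nat"
begin

datatype 'a letter = Gen 'a | Inv 'a

text \<open>
  The congruence on words over the letters \<open>a\<close>, \<open>a\<close> inverse that is generated by free cancellation
  and the defining relations \<open>r = s\<close> for \<open>(r, s) \<in> R\<close>; its classes are the elements of the group
  presented by \<open>R\<close>, with one generator for every element of the type \<open>'a\<close>.
\<close>

inductive pres_cong :: "('a letter list \<times> 'a letter list) set \<Rightarrow> 'a letter list \<Rightarrow> 'a letter list \<Rightarrow> bool"
  for R where
  refl: "pres_cong R u u"
| sym: "pres_cong R u v \<Longrightarrow> pres_cong R v u"
| trans: "pres_cong R u v \<Longrightarrow> pres_cong R v w \<Longrightarrow> pres_cong R u w"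
| cancel_Gen_Inv: "pres_cong R (u @ [Gen a, Inv a] @ v) (u @ v)"
| cancel_Inv_Gen: "pres_cong R (u @ [Inv a, Gen a] @ v) (u @ v)"
| relation: "(r, s) \<in> R \<Longrightarrow> pres_cong R (u @ r @ v) (u @ s @ v)"

definition pres_class :: "('a letter list \<times> 'a letter list) set \<Rightarrow> 'a letter list \<Rightarrow> 'a letter list set" where
  "pres_class R u = {v. pres_cong R u v}"

definition presented_group :: "('a letter list \<times> 'a letter list) set \<Rightarrow> 'a letter list set monoid" where
  "presented_group R =
     \<lparr>carrier = range (pres_class R),
      mult = (\<lambda>A B. \<Union>u\<in>A. \<Union>v\<in>B. pres_class R (u @ v)),
      one = pres_class R []\<rparr>"

lemma pres_cong_append_left: "pres_cong R u v \<Longrightarrow> pres_cong R (w @ u) (w @ v)"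
proof (induction rule: pres_cong.induct)
  case (cancel_Gen_Inv u a v)
  show ?case using pres_cong.cancel_Gen_Inv[of R "w @ u" a v] by simp
next
  case (cancel_Inv_Gen u a v)
  show ?case using pres_cong.cancel_Inv_Gen[of R "w @ u" a v] by simp
next
  case (relation r s u v)
  then show ?case using pres_cong.relation[of r s R "w @ u" v] by simp
next
  case (trans u v w)
  show ?case by (rule pres_cong.trans[OF trans.IH])
next
  case (sym u v)
  show ?case by (rule pres_cong.sym[OF sym.IH])
qed (rule pres_cong.refl)

lemma pres_cong_append_right: "pres_cong R u v \<Longrightarrow> pres_cong R (u @ w) (v @ w)"
proof (induction rule: pres_cong.induct)
  case (cancel_Gen_Inv u a v)
  show ?case using pres_cong.cancel_Gen_Inv[of R u a "v @ w"] by simp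
next
  case (cancel_Inv_Gen u a v)
  show ?case using pres_cong.cancel_Inv_Gen[of R u a "v @ w"] by simp
next
  case (relation r s u v)
  then show ?case using pres_cong.relation[of r s R u "v @ w"] by simp
next
  case (trans u v w)
  show ?case by (rule pres_cong.trans[OF trans.IH])
next
  case (sym u v)
  show ?case by (rule pres_cong.sym[OF sym.IH])
qed (rule pres_cong.refl)

lemma pres_class_eq_iff: "pres_class R u = pres_class R v \<longleftrightarrow> pres_cong R u v"
proof
  assume "pres_class R u = pres_class R v"
  then show "pres_cong R u v"
    using pres_cong.refl[of R v] by (auto simp: pres_class_def)
next
  assume uv: "pres_cong R u v"
  show "pres_class R u = pres_class R v"
    unfolding pres_class_def
    using pres_cong.trans[OF uv] pres_cong.trans[OF pres_cong.sym[OF uv]] by blast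
qed

lemma pres_class_self: "u \<in> pres_class R u"
  by (simp add: pres_class_def pres_cong.refl)

lemma mult_presented_group:
  "pres_class R u \<otimes>\<^bsub>presented_group R\<^esub> pres_class R v = pres_class R (u @ v)"
proof -
  have "pres_class R (u' @ v') = pres_class R (u @ v)"
    if "u' \<in> pres_class R u" "v' \<in> pres_class R v" for u' v'
  proof -
    have u: "pres_cong R u u'" and v: "pres_cong R v v'"
      using that by (simp_all add: pres_class_def)
    have "pres_cong R (u @ v) (u' @ v')"
      by (rule pres_cong.trans[OF pres_cong_append_right[OF u] pres_cong_append_left[OF v]])
    then show ?thesis
      unfolding pres_class_eq_iff by (rule pres_cong.sym)
  qed
  then have "(\<Union>u'\<in>pres_class R u. \<Union>v'\<in>pres_class R v. pres_class R (u' @ v')) =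
      (\<Union>u'\<in>pres_class R u. \<Union>v'\<in>pres_class R v. pres_class R (u @ v))"
    by (intro SUP_cong HOL.refl)
  also have "\<dots> = pres_class R (u @ v)"
    using pres_class_self[of u R] pres_class_self[of v R] by fast
  finally show ?thesis by (simp add: presented_group_def)
qed

fun inv_letter :: "'a letter \<Rightarrow> 'a letter" where
  "inv_letter (Gen a) = Inv a"
| "inv_letter (Inv a) = Gen a"

lemma pres_cong_inverse: "pres_cong R (rev (map inv_letter u) @ u) []"
proof (induction u)
  case Nil
  show ?case by (simp add: pres_cong.refl)
next
  case (Cons l u)
  have "pres_cong R (rev (map inv_letter u) @ [inv_letter l, l] @ u) (rev (map inv_letter u) @ u)"
    by (cases l) (simp_all only: inv_letter.simps pres_cong.cancel_Gen_Inv pres_cong.cancel_Inv_Gen)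
  then have "pres_cong R (rev (map inv_letter u) @ [inv_letter l, l] @ u) []"
    using Cons.IH by (rule pres_cong.trans)
  then show ?case by simp
qed

lemma carrier_presented_group: "carrier (presented_group R) = range (pres_class R)"
  by (simp add: presented_group_def)

lemma one_presented_group: "\<one>\<^bsub>presented_group R\<^esub> = pres_class R []"
  by (simp add: presented_group_def)

lemma group_presented_group: "group (presented_group R)"
proof (rule groupI)
  fix x assume "x \<in> carrier (presented_group R)"
  then obtain u where "x = pres_class R u"
    by (auto simp: carrier_presented_group)
  then have "pres_class R (rev (map inv_letter u)) \<otimes>\<^bsub>presented_group R\<^esub> x = \<one>\<^bsub>presented_group R\<^esub>"
    using pres_cong_inverse[of R u]
    by (simp add: mult_presented_group one_presented_group pres_class_eq_iff)
  then show "\<exists>y\<in>carrier (presented_group R). y \<otimes>\<^bsub>presented_group R\<^esub> x = \<one>\<^bsub>presented_group R\<^esub>"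
    by (auto simp: carrier_presented_group)
qed (auto simp: carrier_presented_group one_presented_group mult_presented_group)

text \<open>
  The word length of an element that is not a product of elements of \<open>S\<close> and their inverses is \<open>\<infinity>\<close>,
  since the infimum of the empty set of extended naturals is \<open>\<infinity>\<close>.
\<close>

definition word_length :: "('g, 'm) monoid_scheme \<Rightarrow> 'g set \<Rightarrow> 'g \<Rightarrow> enat" where
  "word_length G S g =
     (INF ws \<in> {ws. set ws \<subseteq> S \<union> m_inv G ` S \<and> foldr (mult G) ws \<one>\<^bsub>G\<^esub> = g}. enat (length ws))"

definition growth_function :: "('g, 'm) monoid_scheme \<Rightarrow> 'g set \<Rightarrow> nat \<Rightarrow> nat" where
  "growth_function G S n = card {g \<in> carrier G. word_length G S g \<le> enat n}"

text \<open>
  For a group and a finite \<open>S\<close> contained in it the limit exists, as the growth function is submultiplicative.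
\<close>

definition growth_rate :: "('g, 'm) monoid_scheme \<Rightarrow> 'g set \<Rightarrow> real" where
  "growth_rate G S = lim (\<lambda>n. root n (real (growth_function G S n)))"

lemma word_length_le_iff:
  "word_length G S g \<le> enat n \<longleftrightarrow>
     (\<exists>ws. set ws \<subseteq> S \<union> m_inv G ` S \<and> foldr (mult G) ws \<one>\<^bsub>G\<^esub> = g \<and> length ws \<le> n)"
  (is "?L \<longleftrightarrow> ?R")
proof
  let ?A = "{ws. set ws \<subseteq> S \<union> m_inv G ` S \<and> foldr (mult G) ws \<one>\<^bsub>G\<^esub> = g}"
  assume L: ?L
  then have "(\<lambda>ws. enat (length ws)) ` ?A \<noteq> {}"
    unfolding word_length_def by (auto simp: Inf_enat_def split: if_splits)
  then have "Inf ((\<lambda>ws. enat (length ws)) ` ?A) \<in> (\<lambda>ws. enat (length ws)) ` ?A"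
    by (meson wellorder_InfI ex_in_conv)
  with L show ?R unfolding word_length_def by auto
next
  assume ?R
  then obtain ws where ws: "set ws \<subseteq> S \<union> m_inv G ` S" "foldr (mult G) ws \<one>\<^bsub>G\<^esub> = g"
    and "length ws \<le> n" by blast
  from ws have "word_length G S g \<le> enat (length ws)"
    unfolding word_length_def by (intro INF_lower) simp
  also have "\<dots> \<le> enat n" using \<open>length ws \<le> n\<close> by simp
  finally show ?L .
qed

definition thompson_rels :: "nat \<Rightarrow> (nat letter list \<times> nat letter list) set" where
  "thompson_rels p = {([Gen j, Gen i], [Gen i, Gen (j + p - 1)]) | i j. i < j}"

definition thompson_group :: "nat \<Rightarrow> nat letter list set monoid" where
  "thompson_group p = presented_group (thompson_rels p)"

definition thompson_gen :: "nat \<Rightarrow> nat \<Rightarrow> nat letter list set" where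
  "thompson_gen p i = pres_class (thompson_rels p) [Gen i]"

definition xi :: "nat \<Rightarrow> real" where
  "xi p = (THE \<xi>::real. \<xi> > 1 \<and> (2 * \<xi> - 1) * (\<xi> - 1) ^ (p - 1) = \<xi> ^ p)"

lemma ex1_xi:
  assumes "p \<ge> 2"
  shows "\<exists>!\<xi>::real. \<xi> > 1 \<and> (2 * \<xi> - 1) * (\<xi> - 1) ^ (p - 1) = \<xi> ^ p"
proof -
  define f :: "real \<Rightarrow> real" where "f t = (2 - t) * (1 - t) ^ (p - 1)" for t
  have eq: "(2 * x - 1) * (x - 1) ^ (p - 1) = x ^ p \<longleftrightarrow> f (1 / x) = 1" if "x > 1" for x :: real
  proof -
    have "x ^ p = x * x ^ (p - 1)" using assms by (cases p) auto
    moreover have "f (1 / x) = (2 * x - 1) * (x - 1) ^ (p - 1) / (x * x ^ (p - 1))"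
    proof -
      have "2 - 1 / x = (2 * x - 1) / x" "1 - 1 / x = (x - 1) / x"
        using that by (simp_all add: field_simps)
      then show ?thesis unfolding f_def by (simp add: power_divide)
    qed
    moreover have "x * x ^ (p - 1) \<noteq> 0" using that by simp
    ultimately show ?thesis by (metis divide_eq_1_iff)
  qed
  have mono: "f t < f s" if "0 \<le> s" "s < t" "t \<le> 1" for s t
  proof -
    have "(1 - t) ^ (p - 1) < (1 - s) ^ (p - 1)"
      using that assms by (intro power_strict_mono) auto
    then show ?thesis unfolding f_def using that
      by (intro mult_strict_mono) auto
  qed
  have "\<exists>t\<ge>0. t \<le> 1 \<and> f t = 1"
  proof (rule IVT2)
    show "f 1 \<le> 1" "1 \<le> f 0" using assms by (auto simp: f_def power_0_left)
  qed (auto simp: f_def intro!: continuous_intros)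
  then obtain t where t: "0 \<le> t" "t \<le> 1" "f t = 1" by blast
  have t01: "t \<noteq> 0" "t \<noteq> 1" using t assms by (auto simp: f_def power_0_left)
  show ?thesis
  proof (rule ex1I[of _ "1 / t"])
    show "1 / t > 1 \<and> (2 * (1 / t) - 1) * (1 / t - 1) ^ (p - 1) = (1 / t) ^ p"
      using t t01 eq[of "1 / t"] by simp
  next
    fix x :: real
    assume x: "x > 1 \<and> (2 * x - 1) * (x - 1) ^ (p - 1) = x ^ p"
    then have "f (1 / x) = f t" using eq[of x] t by simp
    moreover have "0 \<le> 1 / x" "1 / x \<le> 1" using x by auto
    ultimately have "1 / x = t" using mono[of t "1 / x"] mono[of "1 / x" t] t by linarith
    then show "x = 1 / t" using x by auto
  qed
qed

end

theory Submission
  imports Defs "HOL-Real_Asymp.Real_Asymp"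
begin

text \<open>
  For \<open>j = r + k (p - 1)\<close> with \<open>1 \<le> r \<le> p - 1\<close> and \<open>k\<close> an integer put \<open>a\<^sub>j = x\<^sub>0\<^bsup>-k\<^esup> x\<^sub>r x\<^sub>0\<^sup>k\<close>. Every element of
  \<open>F(p)\<close> is a word in the \<open>a\<^sub>j\<close> times a power of \<open>x\<^sub>0\<close>, and \<open>a\<^sub>j a\<^sub>i = a\<^sub>i a\<^sub>j\<^sub>+\<^sub>p\<^sub>-\<^sub>1\<close> for \<open>i < j\<close> yields normal
  forms. That different normal forms are different elements follows by letting the group act on
  normal forms (van der Waerden's argument). Those words in \<open>x\<^sub>0, \<dots>, x\<^sub>p\<^sub>-\<^sub>1\<close> that spell a normal form without
  detours make up a regular language, whose automaton has an explicit positive eigenvector with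
  eigenvalue \<open>\<xi>\<^sub>p\<close>; hence the balls contain at least \<open>c \<xi>\<^sub>p\<^sup>n\<close> elements.

  For the asymptotics, the logarithm of \<open>(2 x - 1) (x - 1)\<^bsup>p - 1\<^esup> / x\<^sup>p\<close> increases in \<open>x\<close>, and at
  \<open>(p - 1/2) / ln 2 + 1/2 + \<epsilon>\<close> it is asymptotically \<open>\<epsilon> (ln 2)\<^sup>2 / p\<close>.
\<close>

section \<open>Growth rates\<close>

text \<open>Fekete's lemma in multiplicative form; the limit is the infimum of the roots over
  \<open>n \<ge> 1\<close>.\<close>

lemma root_convergent_submultiplicative:
  fixes a :: "nat \<Rightarrow> real"
  assumes ge1: "\<And>n. a n \<ge> 1" and submult: "\<And>m n. a (m + n) \<le> a m * a n"
  shows "convergent (\<lambda>n. root n (a n))"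
proof -
  define b where "b n = root n (a n)" for n
  define L where "L = Inf (b ` {1..})"
  have b_ge1: "b n \<ge> 1" if "n \<ge> 1" for n
    using that ge1[of n] by (simp add: b_def)
  then have bdd: "bdd_below (b ` {1..})" by (intro bdd_belowI[of _ 1]) auto
  have L_le: "L \<le> b n" if "n \<ge> 1" for n
    unfolding L_def using that by (intro cInf_lower bdd) auto
  have power_bound: "a (m * k) \<le> a m ^ k" if "k \<ge> 1" for m k
    using that
  proof (induction k rule: nat_induct_at_least)
    case (Suc k)
    have "a (m * Suc k) \<le> a m * a (m * k)" using submult[of m "m * k"] by simp
    also have "\<dots> \<le> a m * a m ^ k" using Suc ge1[of m] by (intro mult_left_mono) auto
    finally show ?case by simp
  qed simp
  \<comment> \<open>Dividing \<open>n\<close> by \<open>m\<close> with remainder \<open>r\<close>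
    bounds \<open>a n\<close> by \<open>a m ^ k * a r\<close>; \<open>C\<close> absorbs the last
    factor, and \<open>root n C\<close> tends to 1.\<close>
  have bound: "\<exists>C\<ge>1. \<forall>n\<ge>m. b n \<le> b m * root n C" if "m \<ge> 1" for m
  proof -
    define C where "C = Max (a ` {..<m})"
    have C: "a r \<le> C" if "r < m" for r using that by (auto simp: C_def)
    have "C \<ge> 1" using C[of 0] ge1[of 0] \<open>m \<ge> 1\<close> by simp
    moreover have "b n \<le> b m * root n C" if "n \<ge> m" for n
    proof -
      define k r where "k = n div m" and "r = n mod m"
      have k: "k \<ge> 1" using that \<open>m \<ge> 1\<close> by (simp add: k_def div_greater_zero_iff Suc_le_eq)
      have n: "n = m * k + r" "r < m" using \<open>m \<ge> 1\<close> by (simp_all add: k_def r_def)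
      have bm: "b m \<ge> 1" "a m = b m ^ m" using b_ge1[of m] ge1[of m] \<open>m \<ge> 1\<close>
        by (simp_all add: b_def)
      have "a n \<le> a (m * k) * a r" using submult n by simp
      also have "\<dots> \<le> a m ^ k * C"
        using power_bound[OF k, of m] C[OF n(2)] ge1[of r] ge1[of m] by (intro mult_mono) auto
      also have "a m ^ k = b m ^ (m * k)" using bm(2) by (simp add: power_mult)
      also have "\<dots> * C \<le> b m ^ n * C"
        using n bm \<open>C \<ge> 1\<close> by (intro mult_right_mono power_increasing) auto
      finally have "root n (a n) \<le> root n (b m ^ n * C)" using that \<open>m \<ge> 1\<close> by simp
      also have "\<dots> = b m * root n C"
        using bm(1) that \<open>m \<ge> 1\<close> by (simp add: real_root_mult real_root_power_cancel)
      finally show ?thesis by (simp add: b_def)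
    qed
    ultimately show ?thesis by blast
  qed
  have "b \<longlonglongrightarrow> L"
  proof (rule order_tendstoI)
    fix y assume "y < L"
    then show "eventually (\<lambda>n. y < b n) sequentially"
      using L_le by (intro eventually_sequentiallyI[of 1]) force
  next
    fix y assume "L < y"
    then obtain m where m: "m \<ge> 1" "b m < y"
      unfolding L_def using bdd by (subst (asm) cInf_less_iff) auto
    obtain C where C: "C \<ge> 1" "\<And>n. n \<ge> m \<Longrightarrow> b n \<le> b m * root n C"
      using bound[OF m(1)] by blast
    have "(\<lambda>n. b m * root n C) \<longlonglongrightarrow> b m * 1"
      using C(1) by (intro tendsto_intros LIMSEQ_root_const) auto
    then have "eventually (\<lambda>n. b m * root n C < y) sequentially"
      using order_tendstoD(2) m(2) by fastforce
    then show "eventually (\<lambda>n. b n < y) sequentially"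
      using eventually_ge_at_top[of m] by eventually_elim (use C(2) in fastforce)
  qed
  then show ?thesis unfolding convergent_def b_def by blast
qed

lemma foldr_mult_append:
  assumes "group G" "set us \<subseteq> carrier G" "set vs \<subseteq> carrier G"
  shows "foldr (mult G) us \<one>\<^bsub>G\<^esub> \<in> carrier G"
    and "foldr (mult G) (us @ vs) \<one>\<^bsub>G\<^esub> = foldr (mult G) us \<one>\<^bsub>G\<^esub> \<otimes>\<^bsub>G\<^esub> foldr (mult G) vs \<one>\<^bsub>G\<^esub>"
proof -
  interpret group G by fact
  have closed: "foldr (mult G) ws \<one>\<^bsub>G\<^esub> \<in> carrier G" if "set ws \<subseteq> carrier G" for ws
    using that by (induction ws) auto
  then show "foldr (mult G) us \<one>\<^bsub>G\<^esub> \<in> carrier G" using assms(2) .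
  show "foldr (mult G) (us @ vs) \<one>\<^bsub>G\<^esub> = foldr (mult G) us \<one>\<^bsub>G\<^esub> \<otimes>\<^bsub>G\<^esub> foldr (mult G) vs \<one>\<^bsub>G\<^esub>"
    using assms(2) by (induction us) (auto simp: closed assms(3) m_assoc)
qed

text \<open>Working with words makes balls finite for finite \<open>S\<close>, and cutting a word
  after \<open>m\<close> letters yields submultiplicativity.\<close>

lemma ball_eq:
  assumes "group G" "S \<subseteq> carrier G"
  shows "{g \<in> carrier G. word_length G S g \<le> enat n} =
    (\<lambda>ws. foldr (mult G) ws \<one>\<^bsub>G\<^esub>) ` {ws. set ws \<subseteq> S \<union> m_inv G ` S \<and> length ws \<le> n}"
proof -
  have "S \<union> m_inv G ` S \<subseteq> carrier G" using assms by (auto intro: group.inv_closed)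
  then have "foldr (mult G) ws \<one>\<^bsub>G\<^esub> \<in> carrier G" if "set ws \<subseteq> S \<union> m_inv G ` S" for ws
    using foldr_mult_append(1)[OF assms(1), of ws "[]"] that by (simp add: subset_trans[OF that])
  then show ?thesis
    unfolding word_length_le_iff by (intro Set.set_eqI iffI; elim CollectE imageE conjE exE) auto
qed

lemma finite_ball:
  assumes "group G" "S \<subseteq> carrier G" "finite S"
  shows "finite {g \<in> carrier G. word_length G S g \<le> enat n}"
  unfolding ball_eq[OF assms(1,2)] using assms(3)
  by (intro finite_imageI finite_lists_length_le) auto

lemma growth_function_ge_1:
  assumes "group G" "S \<subseteq> carrier G" "finite S"
  shows "growth_function G S n \<ge> 1"
proof -
  have "{g \<in> carrier G. word_length G S g \<le> enat n} \<noteq> {}"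
    unfolding ball_eq[OF assms(1,2)] by (auto intro: exI[of _ "[]"])
  then show ?thesis
    using finite_ball[OF assms] by (simp add: growth_function_def Suc_le_eq card_gt_0_iff)
qed

lemma growth_function_submultiplicative:
  assumes "group G" "S \<subseteq> carrier G" "finite S"
  shows "growth_function G S (m + n) \<le> growth_function G S m * growth_function G S n"
proof -
  define B where "B n = {g \<in> carrier G. word_length G S g \<le> enat n}" for n
  have S: "S \<union> m_inv G ` S \<subseteq> carrier G" using assms by (auto intro: group.inv_closed)
  have "B (m + n) \<subseteq> (\<lambda>(g, h). g \<otimes>\<^bsub>G\<^esub> h) ` (B m \<times> B n)"
  proof
    fix g assume "g \<in> B (m + n)"
    then obtain ws where ws: "set ws \<subseteq> S \<union> m_inv G ` S" "length ws \<le> m + n"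
      "g = foldr (mult G) ws \<one>\<^bsub>G\<^esub>"
      unfolding B_def ball_eq[OF assms(1,2)] by blast
    define us vs where "us = take m ws" and "vs = drop m ws"
    have uv_S: "set us \<subseteq> S \<union> m_inv G ` S" "set vs \<subseteq> S \<union> m_inv G ` S"
      using ws(1) unfolding us_def vs_def by (meson order.trans set_take_subset set_drop_subset)+
    have uv: "ws = us @ vs" "length us \<le> m" "length vs \<le> n" using ws(2) by (auto simp: us_def vs_def)
    have "g = foldr (mult G) us \<one>\<^bsub>G\<^esub> \<otimes>\<^bsub>G\<^esub> foldr (mult G) vs \<one>\<^bsub>G\<^esub>"
      unfolding ws(3) uv(1)
      by (rule foldr_mult_append(2)[OF assms(1) subset_trans[OF uv_S(1) S] subset_trans[OF uv_S(2) S]])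
    moreover have "foldr (mult G) us \<one>\<^bsub>G\<^esub> \<in> B m"
      unfolding B_def ball_eq[OF assms(1,2)] using uv(2) uv_S(1) by (intro imageI CollectI conjI)
    moreover have "foldr (mult G) vs \<one>\<^bsub>G\<^esub> \<in> B n"
      unfolding B_def ball_eq[OF assms(1,2)] using uv(3) uv_S(2) by (intro imageI CollectI conjI)
    ultimately show "g \<in> (\<lambda>(g, h). g \<otimes>\<^bsub>G\<^esub> h) ` (B m \<times> B n)"
      by (intro image_eqI[where x = "(foldr (mult G) us \<one>\<^bsub>G\<^esub>, foldr (mult G) vs \<one>\<^bsub>G\<^esub>)"])
         (simp_all only: case_prod_conv SigmaI)
  qed
  moreover have "finite (B m \<times> B n)"
    unfolding B_def by (intro finite_cartesian_product finite_ball[OF assms])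
  ultimately have "card (B (m + n)) \<le> card (B m \<times> B n)" by (rule surj_card_le[rotated])
  then show ?thesis by (simp add: growth_function_def B_def card_cartesian_product)
qed

text \<open>Since \<open>lim\<close> is meaningful only for convergent sequences, Fekete's lemma
  comes first; then \<open>c\<close> drops out because its \<open>n\<close>-th root tends to
  1.\<close>

lemma growth_rate_ge:
  assumes "group G" "S \<subseteq> carrier G" "finite S"
    and "c > 0" "\<xi> \<ge> 0" and bound: "\<And>n. c * \<xi> ^ n \<le> real (growth_function G S n)"
  shows "\<xi> \<le> growth_rate G S"
proof (rule LIMSEQ_le)
  have "convergent (\<lambda>n. root n (real (growth_function G S n)))"
  proof (rule root_convergent_submultiplicative)
    show "real (growth_function G S (m + n)) \<le> real (growth_function G S m) * real (growth_function G S n)" for m n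
      using growth_function_submultiplicative[OF assms(1-3), of m n] by (metis of_nat_mult of_nat_le_iff)
    show "1 \<le> real (growth_function G S n)" for n
      using growth_function_ge_1[OF assms(1-3)] by simp
  qed
  then show "(\<lambda>n. root n (real (growth_function G S n))) \<longlonglongrightarrow> growth_rate G S"
    unfolding growth_rate_def by (simp add: convergent_LIMSEQ_iff)
  have "(\<lambda>n. root n c * \<xi>) \<longlonglongrightarrow> 1 * \<xi>"
    using \<open>c > 0\<close> by (intro tendsto_intros LIMSEQ_root_const)
  then show "(\<lambda>n. root n c * \<xi>) \<longlonglongrightarrow> \<xi>" by simp
  have "root n c * \<xi> \<le> root n (real (growth_function G S n))" if "n \<ge> 1" for n
  proof -
    have "root n c * \<xi> = root n (c * \<xi> ^ n)"
      using that \<open>\<xi> \<ge> 0\<close> by (simp add: real_root_mult real_root_power_cancel)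
    also have "\<dots> \<le> root n (real (growth_function G S n))" using that bound by simp
    finally show ?thesis .
  qed
  then show "\<exists>N. \<forall>n\<ge>N. root n c * \<xi> \<le> root n (real (growth_function G S n))" by blast
qed

section \<open>Normal forms\<close>

text \<open>
  The entry \<open>(j, e)\<close> stands for \<open>a\<^sub>j\<close> if \<open>e\<close> and for its inverse otherwise. With \<open>q = p - 1\<close>, the relation
  \<open>a\<^sub>j a\<^sub>i = a\<^sub>i a\<^sub>j\<^sub>+\<^sub>q\<close> for \<open>i < j\<close> is oriented so as to move the smaller index to the left; \<open>nf_ok\<close> says that
  neither it nor a cancellation applies to two neighbours.
\<close>

definition nf_ok :: "int \<Rightarrow> int \<times> bool \<Rightarrow> int \<times> bool \<Rightarrow> bool" where
  "nf_ok q x y \<longleftrightarrow>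
     fst x \<le> (if snd y then fst y else fst y + q) \<and> \<not> (fst x = fst y \<and> snd x \<noteq> snd y)"

lemma nf_ok_Pair:
  "nf_ok q (i, e) (j, d) \<longleftrightarrow> i \<le> (if d then j else j + q) \<and> \<not> (i = j \<and> e \<noteq> d)"
  by (simp add: nf_ok_def)

abbreviation nf :: "int \<Rightarrow> (int \<times> bool) list \<Rightarrow> bool" where
  "nf q \<equiv> successively (nf_ok q)"

text \<open>Left multiplication of a normal form by \<open>a_i\<close> or its inverse. The letter
  moves right by \<open>a_i a_j = a_j a_(i+q)\<close> for \<open>j < i\<close> and
  \<open>a_i a_j^-1 = a_j^-1 a_(i-q)\<close> for \<open>j + q < i\<close>, until it cancels or
  fits.\<close>

fun nf_ins :: "int \<Rightarrow> int \<Rightarrow> bool \<Rightarrow> (int \<times> bool) list \<Rightarrow> (int \<times> bool) list" where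
  "nf_ins q i e [] = [(i, e)]"
| "nf_ins q i e ((j, d) # w) =
     (if i = j \<and> e \<noteq> d then w
      else if nf_ok q (i, e) (j, d) then (i, e) # (j, d) # w
      else (j, d) # nf_ins q (if d then i + q else i - q) e w)"

lemma nf_Cons: "nf q (x # w) \<longleftrightarrow> (w = [] \<or> nf_ok q x (hd w)) \<and> nf q w"
  by (cases w) auto

lemma nf_ins_Cons: "w = [] \<or> nf_ok q (i, e) (hd w) \<Longrightarrow> nf_ins q i e w = (i, e) # w"
  by (cases w rule: list.exhaust) (auto simp: nf_ok_Pair)

lemma nf_nf_ins:
  assumes "q \<ge> 0" "nf q w"
  shows "nf q (nf_ins q i e w)"
  using assms(2)
proof (induction w arbitrary: i)
  case Nil
  then show ?case by simp
next
  case (Cons x w)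
  obtain j d where x: "x = (j, d)" by force
  define i' where "i' = (if d then i + q else i - q)"
  have "nf q (nf_ins q i' e w)" using Cons by (auto simp: nf_Cons)
  \<comment> \<open>The neighbour of \<open>(j, d)\<close> is now the old one, the inserted letter
    or, after a cancellation, the second entry of \<open>w\<close>; in the last two cases
    \<open>j < i'\<close> is what decides.\<close>
  moreover have "nf_ok q (j, d) (hd (nf_ins q i' e w))"
    if "nf_ins q i' e w \<noteq> []" "\<not> (i = j \<and> e \<noteq> d)" "\<not> nf_ok q (i, e) (j, d)"
    using that Cons.prems \<open>q \<ge> 0\<close> unfolding x i'_def
    by (cases w; cases "tl w") (auto simp: nf_ok_Pair split: if_splits)
  ultimately have "nf q ((j, d) # nf_ins q i' e w)"
    if "\<not> (i = j \<and> e \<noteq> d)" "\<not> nf_ok q (i, e) (j, d)"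
    using that by (simp only: nf_Cons) blast
  then show ?case
    using Cons.prems unfolding x nf_ins.simps i'_def by (auto simp: nf_Cons)
qed

text \<open>The inverse letter passes the same entries as the first one did and then undoes its
  insertion or cancellation, so letters permute the normal forms.\<close>

lemma nf_ins_inverse:
  assumes "q \<ge> 0" "nf q w"
  shows "nf_ins q i (\<not> e) (nf_ins q i e w) = w"
  using assms(2)
proof (induction w arbitrary: i)
  case Nil
  then show ?case by simp
next
  case (Cons x w)
  obtain j d where x: "x = (j, d)" by force
  show ?case
  proof (cases "i = j \<and> e \<noteq> d")
    case True
    then have "nf_ins q j d w = (j, d) # w"
      using Cons.prems by (intro nf_ins_Cons) (auto simp: x nf_Cons)
    moreover have "d = (\<not> e)" using True by auto
    ultimately show ?thesis using True by (simp add: x)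
  next
    case False
    then show ?thesis using Cons \<open>q \<ge> 0\<close>
      by (auto simp: x nf_Cons nf_ok_Pair split: if_splits)
  qed
qed

text \<open>This is the relation \<open>a_j a_i = a_i a_(j+q)\<close> for the action, with either
  sign on \<open>a_j\<close>. The cases follow \<open>a_i\<close>: it cancels the head, stops in
  front of it or passes it.\<close>

lemma nf_ins_commute:
  assumes "q \<ge> 0" "nf q w" "i < j"
  shows "nf_ins q j e (nf_ins q i True w) = nf_ins q i True (nf_ins q (j + q) e w)"
  using assms(2,3)
proof (induction w arbitrary: i j)
  case Nil
  then show ?case using \<open>q \<ge> 0\<close> by (auto simp: nf_ok_Pair)
next
  case (Cons x w)
  obtain k d where x: "x = (k, d)" by force
  have w: "nf q w" using Cons.prems by (simp add: nf_Cons)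
  consider (cancel) "i = k" "\<not> d" | (ok) "nf_ok q (i, True) (k, d)"
    | (pass) "\<not> (i = k \<and> \<not> d)" "\<not> nf_ok q (i, True) (k, d)" by blast
  then show ?case
  proof cases
    case cancel
    then show ?thesis using Cons.prems \<open>q \<ge> 0\<close> by (auto simp: x nf_ok_Pair)
  next
    case ok
    let ?v = "nf_ins q (j + q) e (x # w)"
    have "nf_ins q j e (nf_ins q i True (x # w)) = (i, True) # ?v"
      using ok Cons.prems \<open>q \<ge> 0\<close> by (cases d) (auto simp: x nf_ok_Pair)
    moreover have "?v = [] \<or> nf_ok q (i, True) (hd ?v)"
      using ok Cons.prems \<open>q \<ge> 0\<close>
      by (cases w) (auto simp: x nf_Cons nf_ok_Pair split: if_splits)
    ultimately show ?thesis by (simp add: nf_ins_Cons)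
  next
    case pass
    \<comment> \<open>An entry that \<open>a_i\<close> passes is also passed by the other letter, as
      \<open>i < j\<close>; both indices change by the same amount, so the induction hypothesis
      applies.\<close>
    define i' where "i' = (if d then i + q else i - q)"
    define j' where "j' = (if d then j + q else j - q)"
    have "nf_ins q j e (nf_ins q i True (x # w)) = x # nf_ins q j' e (nf_ins q i' True w)"
      using pass Cons.prems \<open>q \<ge> 0\<close> by (auto simp: x nf_ok_Pair i'_def j'_def)
    also have "nf_ins q j' e (nf_ins q i' True w) = nf_ins q i' True (nf_ins q (j' + q) e w)"
      using Cons.prems by (intro Cons.IH w) (auto simp: i'_def j'_def)
    also have "x # \<dots> = nf_ins q i True (nf_ins q (j + q) e (x # w))"
      using pass Cons.prems \<open>q \<ge> 0\<close> by (auto simp: x nf_ok_Pair i'_def j'_def)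
    finally show ?thesis .
  qed
qed

section \<open>The action of the group on normal forms\<close>

definition nf_shift :: "int \<Rightarrow> (int \<times> bool) list \<Rightarrow> (int \<times> bool) list" where
  "nf_shift k = map (map_prod (\<lambda>j. j + k) id)"

lemma nf_nf_shift [simp]: "nf q (nf_shift k w) \<longleftrightarrow> nf q w"
proof (induction w)
  case (Cons x w)
  then show ?case by (cases x; cases w) (auto simp: nf_shift_def nf_ok_Pair)
qed (simp add: nf_shift_def)

lemma nf_shift_shift: "nf_shift k (nf_shift l w) = nf_shift (k + l) w"
  by (auto simp: nf_shift_def)

lemma nf_shift_0 [simp]: "nf_shift 0 w = w"
  by (auto simp: nf_shift_def map_prod_def)

text \<open>Insertion depends only on differences of indices; this yields the relations that involve
  \<open>x_0\<close>.\<close>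

lemma nf_shift_ins: "nf_shift k (nf_ins q i e w) = nf_ins q (i + k) e (nf_shift k w)"
  by (induction w arbitrary: i) (auto simp: nf_shift_def nf_ok_Pair algebra_simps)

text \<open>
  Left multiplication of a pair \<open>(w, k)\<close>, which represents \<open>w x\<^sub>0\<^sup>k\<close>; moving \<open>x\<^sub>0\<close> past \<open>w\<close> shifts indices.
\<close>

fun letter_act :: "nat \<Rightarrow> nat letter \<Rightarrow> (int \<times> bool) list \<times> int \<Rightarrow> (int \<times> bool) list \<times> int" where
  "letter_act q (Gen i) (w, k) =
     (if i = 0 then (nf_shift (- int q) w, k + 1) else (nf_ins (int q) (int i) True w, k))"
| "letter_act q (Inv i) (w, k) =
     (if i = 0 then (nf_shift (int q) w, k - 1) else (nf_ins (int q) (int i) False w, k))"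

abbreviation word_act :: "nat \<Rightarrow> nat letter list \<Rightarrow> (int \<times> bool) list \<times> int \<Rightarrow> (int \<times> bool) list \<times> int" where
  "word_act q \<equiv> foldr (letter_act q)"

lemma nf_letter_act: "nf (int q) (fst s) \<Longrightarrow> nf (int q) (fst (letter_act q l s))"
  by (cases l; cases s) (auto simp: nf_nf_ins)

lemma nf_word_act: "nf (int q) (fst s) \<Longrightarrow> nf (int q) (fst (word_act q u s))"
  by (induction u) (auto simp: nf_letter_act)

lemma letter_act_inverse:
  "nf (int q) (fst s) \<Longrightarrow> letter_act q (Gen a) (letter_act q (Inv a) s) = s"
  "nf (int q) (fst s) \<Longrightarrow> letter_act q (Inv a) (letter_act q (Gen a) s) = s"
  using nf_ins_inverse[of "int q" "fst s" a True] nf_ins_inverse[of "int q" "fst s" a False]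
  by (cases s; simp add: nf_shift_shift)+

lemma letter_act_relation:
  assumes "nf (int q) (fst s)" "i < j"
  shows "letter_act q (Gen j) (letter_act q (Gen i) s) =
         letter_act q (Gen i) (letter_act q (Gen (j + q)) s)"
proof (cases s)
  case (Pair w k)
  have "nf_ins (int q) (int j) True (nf_ins (int q) (int i) True w) =
        nf_ins (int q) (int i) True (nf_ins (int q) (int j + int q) True w)"
    using assms Pair by (intro nf_ins_commute) auto
  then show ?thesis using assms Pair by (auto simp: nf_shift_ins)
qed

text \<open>Hence words that act differently on \<open>([], 0)\<close> represent different group
  elements.\<close>

lemma word_act_cong:
  assumes "p \<ge> 2" "pres_cong (thompson_rels p) u v" "nf (int (p - 1)) (fst st)"
  shows "word_act (p - 1) u st = word_act (p - 1) v st"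
  using assms(2)
proof (induction rule: pres_cong.induct)
  case (relation r s u v)
  then obtain i j where rs: "r = [Gen j, Gen i]" "s = [Gen i, Gen (j + (p - 1))]" "i < j"
    using \<open>p \<ge> 2\<close> by (auto simp: thompson_rels_def)
  have "word_act (p - 1) r (word_act (p - 1) v st) = word_act (p - 1) s (word_act (p - 1) v st)"
    using letter_act_relation[OF nf_word_act[OF assms(3)] rs(3)] by (simp add: rs)
  then show ?case by simp
qed (simp_all add: letter_act_inverse[OF nf_word_act[OF assms(3)]] del: One_nat_def)

section \<open>A regular language of normal forms\<close>

text \<open>
  A word \<open>x\<^sub>r x\<^sub>0\<^sup>d x\<^sub>s\<close> (up to signs of the outer letters) puts indices \<open>r\<close> and \<open>s - d q\<close> next to each other.
  The automaton accepts the words whose neighbours all satisfy \<open>nf_ok\<close>: \<open>After r e\<close> is entered by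
  reading \<open>x\<^sub>r\<close> with sign \<open>e\<close>, \<open>Pos r\<close> by reading \<open>x\<^sub>0\<close> after that, and \<open>Free\<close> by reading the inverse of \<open>x\<^sub>0\<close>,
  after which no condition on the next index is left.
\<close>

datatype nf_state = Free | After nat bool | Pos nat

text \<open>In state \<open>Pos r\<close> a letter \<open>x_s\<close> contributes the index
  \<open>s - q \<le> 0\<close>, which may follow \<open>r\<close> only with inverse sign and
  \<open>r \<le> s\<close>; a second \<open>x_0\<close> would rule out every continuation.\<close>

fun nf_step :: "nat \<Rightarrow> nf_state \<Rightarrow> nat letter \<Rightarrow> nf_state option" where
  "nf_step p Free (Gen i) = (if 1 \<le> i \<and> i < p then Some (After i True) else None)"
| "nf_step p Free (Inv i) =
     (if i = 0 then Some Free else if i < p then Some (After i False) else None)"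
| "nf_step p (After r e) (Gen i) =
     (if i = 0 then Some (Pos r)
      else if r \<le> i \<and> i < p \<and> (i = r \<longrightarrow> e) then Some (After i True) else None)"
| "nf_step p (After r e) (Inv i) =
     (if i = 0 then Some Free
      else if i < p \<and> (i = r \<longrightarrow> \<not> e) then Some (After i False) else None)"
| "nf_step p (Pos r) (Gen i) = None"
| "nf_step p (Pos r) (Inv i) = (if 1 \<le> i \<and> r \<le> i \<and> i < p then Some (After i False) else None)"

fun nf_accepts :: "nat \<Rightarrow> nf_state \<Rightarrow> nat letter list \<Rightarrow> bool" where
  "nf_accepts p s [] \<longleftrightarrow> True"
| "nf_accepts p s (l # u) \<longleftrightarrow> (case nf_step p s l of None \<Rightarrow> False | Some s' \<Rightarrow> nf_accepts p s' u)"

fun nf_valid :: "nat \<Rightarrow> nf_state \<Rightarrow> bool" where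
  "nf_valid p Free \<longleftrightarrow> True"
| "nf_valid p (After r e) \<longleftrightarrow> 1 \<le> r \<and> r < p"
| "nf_valid p (Pos r) \<longleftrightarrow> 1 \<le> r \<and> r < p"

definition letters_below :: "nat \<Rightarrow> nat letter set" where
  "letters_below p = Gen ` {..<p} \<union> Inv ` {..<p}"

lemma finite_letters_below: "finite (letters_below p)"
  by (simp add: letters_below_def)

lemma nf_valid_step: "nf_valid p s \<Longrightarrow> nf_step p s l = Some s' \<Longrightarrow> nf_valid p s'"
  by (cases "(p, s, l)" rule: nf_step.cases) (auto split: if_splits)

lemma nf_step_letter: "p > 0 \<Longrightarrow> nf_step p s l = Some s' \<Longrightarrow> l \<in> letters_below p"
  by (cases "(p, s, l)" rule: nf_step.cases) (auto simp: letters_below_def split: if_splits)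

lemma nf_accepts_letters: "p > 0 \<Longrightarrow> nf_accepts p s u \<Longrightarrow> set u \<subseteq> letters_below p"
  by (induction u arbitrary: s) (auto simp: nf_step_letter split: option.splits)

text \<open>The pair \<open>(w, k)\<close> is the value of the part of the word still to be read
  from the given state, so the invariant is propagated from the end of the word to its
  start.\<close>

fun nf_state_inv :: "nat \<Rightarrow> nf_state \<Rightarrow> (int \<times> bool) list \<times> int \<Rightarrow> bool" where
  "nf_state_inv q Free (w, k) \<longleftrightarrow> (if w = [] then k \<le> 0 else fst (hd w) \<ge> 1)"
| "nf_state_inv q (After r e) (w, k) \<longleftrightarrow> w = [] \<or> nf_ok (int q) (int r, e) (hd w)"
| "nf_state_inv q (Pos r) (w, k) \<longleftrightarrow>
     (if w = [] then k = 0 else int r \<le> fst (hd w) \<and> fst (hd w) \<le> int q \<and> \<not> snd (hd w))"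

lemma nf_shift_Nil_iff [simp]: "nf_shift k w = [] \<longleftrightarrow> w = []"
  by (simp add: nf_shift_def)

lemma hd_nf_shift: "w \<noteq> [] \<Longrightarrow> hd (nf_shift k w) = (fst (hd w) + k, snd (hd w))"
  by (cases w) (auto simp: nf_shift_def)

text \<open>By the invariant for \<open>s'\<close>, a letter other than \<open>x_0\<close> is put in
  front of \<open>w\<close> without any rewriting.\<close>

lemma nf_state_inv_step:
  assumes "p \<ge> 2" "nf_valid p s" "nf_step p s l = Some s'" "nf_state_inv (p - 1) s' (w, k)"
  shows "nf_state_inv (p - 1) s (letter_act (p - 1) l (w, k))"
  using assms
  by (cases "(p, s, l)" rule: nf_step.cases; cases "hd w")
     (auto simp: nf_ins_Cons nf_ok_Pair hd_nf_shift of_nat_diff split: if_splits)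

lemma nf_state_inv_word:
  assumes "p \<ge> 2" "nf_valid p s" "nf_accepts p s u"
  shows "nf_state_inv (p - 1) s (word_act (p - 1) u ([], 0))"
  using assms(2,3)
proof (induction u arbitrary: s)
  case Nil
  then show ?case by (cases s) auto
next
  case (Cons l u)
  then obtain s' where s': "nf_step p s l = Some s'" "nf_accepts p s' u"
    by (auto split: option.splits)
  obtain w k where wk: "word_act (p - 1) u ([], 0) = (w, k)" by force
  have "nf_state_inv (p - 1) s' (w, k)"
    using Cons.IH[OF nf_valid_step[OF Cons.prems(1) s'(1)] s'(2)] unfolding wk .
  from nf_state_inv_step[OF assms(1) Cons.prems(1) s'(1) this] show ?case by (simp add: wk del: One_nat_def)
qed

text \<open>A decoder for values of accepted words: the leading index lies in \<open>1..q\<close>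
  exactly if the word starts with a letter other than \<open>x_0\<close> and its inverse.
  \<open>None\<close> marks the empty word.\<close>

fun first_letter :: "nat \<Rightarrow> (int \<times> bool) list \<times> int \<Rightarrow> nat letter option" where
  "first_letter q ([], k) = (if k = 0 then None else Some (if k > 0 then Gen 0 else Inv 0))"
| "first_letter q ((j, e) # w, k) =
     Some (if j \<le> 0 then Gen 0 else if j > int q then Inv 0 else if e then Gen (nat j) else Inv (nat j))"

lemma first_letter_word:
  assumes "p \<ge> 2" "nf_valid p s" "nf_accepts p s (l # u)"
  shows "first_letter (p - 1) (word_act (p - 1) (l # u) ([], 0)) = Some l"
proof -
  obtain s' where s': "nf_step p s l = Some s'" "nf_accepts p s' u"
    using assms(3) by (auto split: option.splits)
  obtain w k where wk: "word_act (p - 1) u ([], 0) = (w, k)" by force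
  have inv: "nf_state_inv (p - 1) s' (w, k)"
    using nf_state_inv_word[OF assms(1) nf_valid_step[OF assms(2) s'(1)] s'(2)] unfolding wk .
  have "first_letter (p - 1) (letter_act (p - 1) l (w, k)) = Some l"
  proof (cases w)
    case Nil
    then show ?thesis using inv s'(1) assms(1,2)
      by (cases "(p, s, l)" rule: nf_step.cases) (auto simp: nf_shift_def split: if_splits)
  next
    case (Cons x v)
    then show ?thesis using inv s'(1) assms(1,2)
      by (cases "(p, s, l)" rule: nf_step.cases; cases x)
         (auto simp: nf_shift_def nf_ins_Cons nf_ok_Pair of_nat_diff split: if_splits)
  qed
  then show ?thesis by (simp add: wk del: One_nat_def)
qed

lemma letter_act_inject:
  assumes "nf (int q) (fst x)" "nf (int q) (fst y)" "letter_act q l x = letter_act q l y"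
  shows "x = y"
  using assms letter_act_inverse[of q x] letter_act_inverse[of q y] by (cases l) metis+

text \<open>Equal values have the same first letter, which leads the deterministic automaton to the
  same state and can be peeled off because letters act injectively.\<close>

lemma word_act_inject:
  assumes "p \<ge> 2" "nf_valid p s" "nf_accepts p s u" "nf_accepts p s v"
    and "word_act (p - 1) u ([], 0) = word_act (p - 1) v ([], 0)"
  shows "u = v"
  using assms(2-)
proof (induction u arbitrary: s v)
  case Nil
  then show ?case using first_letter_word[OF assms(1) Nil(1)] by (cases v) fastforce+
next
  case (Cons l u)
  note first = first_letter_word[OF assms(1) Cons.prems(1)]
  have "v \<noteq> []" using first[OF Cons.prems(2)] Cons.prems(4) by auto
  then obtain l' v' where v: "v = l' # v'" by (cases v) auto
  have l: "l' = l"
    using first[OF Cons.prems(2)] first[of l' v'] Cons.prems(3,4) by (simp add: v del: foldr.simps One_nat_def)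
  obtain s' where s': "nf_step p s l = Some s'" "nf_accepts p s' u" "nf_accepts p s' v'"
    using Cons.prems(2,3) by (auto simp: v l split: option.splits)
  have "word_act (p - 1) u ([], 0) = word_act (p - 1) v' ([], 0)"
  proof (rule letter_act_inject)
    show "letter_act (p - 1) l (word_act (p - 1) u ([], 0)) =
          letter_act (p - 1) l (word_act (p - 1) v' ([], 0))"
      using Cons.prems(4) by (simp add: v l)
  qed (rule nf_word_act, simp)+
  then have "u = v'"
    using s' Cons.IH nf_valid_step[OF Cons.prems(1) s'(1)] by blast
  then show ?case by (simp add: v l)
qed

section \<open>Counting accepted words by the transfer matrix\<close>

lemma card_nf_accepts_Suc:
  assumes "p > 0"
  shows "card {u. length u = Suc n \<and> nf_accepts p s u} =
    (\<Sum>l\<in>letters_below p. case nf_step p s l of None \<Rightarrow> 0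
        | Some s' \<Rightarrow> card {u. length u = n \<and> nf_accepts p s' u})"
proof -
  define W where "W n s = {u. length u = n \<and> nf_accepts p s u}" for n s
  define V where "V l = (case nf_step p s l of None \<Rightarrow> {} | Some s' \<Rightarrow> W n s')" for l
  have "W n s \<subseteq> {u. set u \<subseteq> letters_below p \<and> length u = n}" for n s
    using nf_accepts_letters[OF assms] by (auto simp: W_def)
  then have fin: "finite (W n s)" for n s
    using finite_lists_length_eq[OF finite_letters_below] finite_subset by blast
  have "W (Suc n) s = (\<lambda>(l, u). l # u) ` (SIGMA l:letters_below p. V l)"
  proof (intro Set.set_eqI iffI)
    fix u assume "u \<in> W (Suc n) s"
    then obtain l v where "u = l # v" "v \<in> V l" "l \<in> letters_below p"
      using nf_step_letter[OF assms, of s]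
      by (cases u) (auto simp: W_def V_def split: option.splits)
    then show "u \<in> (\<lambda>(l, u). l # u) ` (SIGMA l:letters_below p. V l)" by force
  qed (auto simp: W_def V_def split: option.splits)
  then have "card (W (Suc n) s) = card (SIGMA l:letters_below p. V l)"
    by (simp add: card_image inj_on_def split_def prod_eq_iff)
  also have "\<dots> = (\<Sum>l\<in>letters_below p. card (V l))"
    using fin finite_letters_below by (intro card_SigmaI) (auto simp: V_def split: option.splits)
  also have "\<dots> = (\<Sum>l\<in>letters_below p. case nf_step p s l of None \<Rightarrow> 0 | Some s' \<Rightarrow> card (W n s'))"
    by (intro sum.cong) (auto simp: V_def split: option.splits)
  finally show ?thesis unfolding W_def .
qed

text \<open>
  The right eigenvector of the adjacency matrix of the automaton for the eigenvalue \<open>1 / t\<close>, where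
  \<open>(2 - t) (1 - t)\<^bsup>p - 1\<^esup> = 1\<close>.
\<close>

fun nf_weight :: "nat \<Rightarrow> real \<Rightarrow> nf_state \<Rightarrow> real" where
  "nf_weight p t Free = 2 * t * (1 - t) ^ (p - 1)"
| "nf_weight p t (After r e) = t * (1 - t) ^ (r - 1)"
| "nf_weight p t (Pos r) = t * ((1 - t) ^ (r - 1) - (1 - t) ^ (p - 1))"

text \<open>The sum telescopes, as
  \<open>t * (1 - t) ^ (i - 1) = (1 - t) ^ (i - 1) - (1 - t) ^ i\<close> for
  \<open>i \<ge> 1\<close>.\<close>

lemma sum_geometric_segment:
  fixes t :: real
  assumes "1 \<le> r" "r \<le> p"
  shows "(\<Sum>i=r..<p. t * (1 - t) ^ (i - 1)) = (1 - t) ^ (r - 1) - (1 - t) ^ (p - 1)"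
  using assms(2)
proof (induction p rule: dec_induct)
  case (step n)
  then have "(1 - t) ^ n = (1 - t) * (1 - t) ^ (n - 1)"
    using assms(1) by (cases n) auto
  with step show ?case by (simp add: algebra_simps)
qed simp

lemma sum_letters_below:
  assumes "p > 0"
  shows "(\<Sum>l\<in>letters_below p. g l :: real) =
    g (Gen 0) + g (Inv 0) + ((\<Sum>i=1..<p. g (Gen i)) + (\<Sum>i=1..<p. g (Inv i)))"
proof -
  have "(\<Sum>l\<in>letters_below p. g l) = (\<Sum>i<p. g (Gen i)) + (\<Sum>i<p. g (Inv i))"
    unfolding letters_below_def
    by (subst sum.union_disjoint) (auto simp: sum.reindex inj_on_def)
  moreover have "{..<p} = insert 0 {1..<p}" using assms by auto
  ultimately show ?thesis by (simp add: algebra_simps)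
qed

lemma nf_weight_eigenvector:
  assumes "p \<ge> 2" "(2 - t) * (1 - t) ^ (p - 1) = 1" "nf_valid p s"
  shows "nf_weight p t s =
    t * (\<Sum>l\<in>letters_below p. case nf_step p s l of None \<Rightarrow> 0 | Some s' \<Rightarrow> nf_weight p t s')"
proof -
  define h where "h i = t * (1 - t) ^ (i - 1)" for i :: nat
  define c where "c = (1 - t) ^ (p - 1)"
  have p_pos: "p > 0" using assms(1) by simp
  \<comment> \<open>The equation for \<open>t\<close> enters only in this form.\<close>
  have c: "1 - c = c - t * c" using assms(2) by (simp add: c_def algebra_simps)
  have sum_h: "(\<Sum>i=r..<p. h i) = (1 - t) ^ (r - 1) - c" if "1 \<le> r" "r < p" for r
    unfolding h_def c_def using that by (intro sum_geometric_segment) auto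
  have sum_if: "(\<Sum>i=1..<p. if P i then h i else 0) = sum h {i \<in> {1..<p}. P i}" for P
    by (rule sum.inter_filter[symmetric]) simp
  have sum_minus: "sum h (A - {r}) = sum h A - h r" if "r \<in> A" "finite A" for A r
    using that by (simp add: sum_diff1)
  let ?g = "\<lambda>l. case nf_step p s l of None \<Rightarrow> 0 | Some s' \<Rightarrow> nf_weight p t s'"
  show ?thesis
  proof (cases s)
    case Free
    have "(\<Sum>i=1..<p. ?g (Gen i)) = (\<Sum>i=1..<p. h i)" "(\<Sum>i=1..<p. ?g (Inv i)) = (\<Sum>i=1..<p. h i)"
      by (auto intro!: sum.cong simp: Free h_def)
    then have "(\<Sum>l\<in>letters_below p. ?g l) = 2 * t * c + 2 * (1 - c)"
      using assms(1) sum_h[of 1] unfolding sum_letters_below[OF p_pos] by (simp add: Free c_def)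
    also have "t * \<dots> = 2 * t * c" unfolding c by (simp add: algebra_simps)
    finally show ?thesis unfolding Free nf_weight.simps c_def by (rule HOL.sym)
  next
    case (After r e)
    then have r: "1 \<le> r" "r < p" using assms(3) by auto
    define a where "a = (1 - t) ^ (r - 1)"
    have "(\<Sum>i=1..<p. ?g (Gen i)) = (\<Sum>i=1..<p. if r \<le> i \<and> (i = r \<longrightarrow> e) then h i else 0)"
      by (auto intro!: sum.cong simp: After h_def)
    also have "\<dots> = sum h {i \<in> {1..<p}. r \<le> i \<and> (i = r \<longrightarrow> e)}" by (rule sum_if)
    also have "{i \<in> {1..<p}. r \<le> i \<and> (i = r \<longrightarrow> e)} = (if e then {r..<p} else {r..<p} - {r})"
      using r by auto
    also have "sum h \<dots> = a - c - (if e then 0 else h r)"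
      using r by (simp add: sum_minus sum_h a_def)
    finally have gen: "(\<Sum>i=1..<p. ?g (Gen i)) = a - c - (if e then 0 else h r)" .
    have "(\<Sum>i=1..<p. ?g (Inv i)) = (\<Sum>i=1..<p. if i = r \<longrightarrow> \<not> e then h i else 0)"
      by (auto intro!: sum.cong simp: After h_def)
    also have "\<dots> = sum h {i \<in> {1..<p}. i = r \<longrightarrow> \<not> e}" by (rule sum_if)
    also have "{i \<in> {1..<p}. i = r \<longrightarrow> \<not> e} = (if e then {1..<p} - {r} else {1..<p})"
      using r by auto
    also have "sum h \<dots> = 1 - c - (if e then h r else 0)"
      using r sum_h[of 1] by (simp add: sum_minus)
    finally have inv: "(\<Sum>i=1..<p. ?g (Inv i)) = 1 - c - (if e then h r else 0)" .
    \<comment> \<open>Of the two letters with index \<open>r\<close> exactly the one cancelling the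
      previous letter is excluded, so \<open>h r\<close> is lost once for either sign
      \<open>e\<close>.\<close>
    have "(\<Sum>l\<in>letters_below p. ?g l) = t * (a - c) + 2 * t * c + (a - c) + (1 - c) - h r"
      unfolding sum_letters_below[OF p_pos] gen inv by (simp add: After a_def c_def)
    also have "h r = t * a" by (simp add: h_def a_def)
    also have "t * (t * (a - c) + 2 * t * c + (a - c) + (1 - c) - t * a) = t * a" unfolding c by (simp add: algebra_simps)
    finally show ?thesis unfolding After nf_weight.simps a_def by (rule HOL.sym)
  next
    case (Pos r)
    then have r: "1 \<le> r" "r < p" using assms(3) by auto
    have "(\<Sum>i=1..<p. ?g (Inv i)) = (\<Sum>i=1..<p. if r \<le> i then h i else 0)"
      by (auto intro!: sum.cong simp: Pos h_def)
    also have "\<dots> = sum h {i \<in> {1..<p}. r \<le> i}" by (rule sum_if)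
    also have "{i \<in> {1..<p}. r \<le> i} = {r..<p}" using r by auto
    also have "sum h \<dots> = (1 - t) ^ (r - 1) - c" using r by (rule sum_h)
    finally have inv: "(\<Sum>i=1..<p. ?g (Inv i)) = (1 - t) ^ (r - 1) - c" .
    have "(\<Sum>l\<in>letters_below p. ?g l) = (1 - t) ^ (r - 1) - c"
      unfolding sum_letters_below[OF p_pos] inv by (simp add: Pos)
    then show ?thesis unfolding Pos nf_weight.simps c_def by simp
  qed
qed

text \<open>At length 0 each state accepts one word and has weight at most 1; each further letter
  multiplies the weights by \<open>1 / t\<close>, as they form an eigenvector.\<close>

lemma card_nf_accepts_ge:
  assumes "p \<ge> 2" "0 < t" "t < 1" "(2 - t) * (1 - t) ^ (p - 1) = 1" "nf_valid p s"
  shows "nf_weight p t s * (1 / t) ^ n \<le> real (card {u. length u = n \<and> nf_accepts p s u})"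
  using assms(5)
proof (induction n arbitrary: s)
  case 0
  have pw: "0 \<le> (1 - t) ^ k" "(1 - t) ^ k \<le> 1" "t * (1 - t) ^ k \<le> 1" for k
    using assms(2,3) by (auto intro!: mult_le_one power_le_one)
  have "(1 - t) ^ (p - 1) \<le> (1 - t) ^ 1"
    using assms(1-3) by (intro power_decreasing) auto
  then have "t * (1 - t) ^ (p - 1) \<le> t * (1 - t)"
    using assms(2) by (intro mult_left_mono) auto
  \<comment> \<open>This gives \<open>t * (1 - t) \<le> 1 / 4\<close>, which bounds the weight of
    \<open>Free\<close>.\<close>
  moreover have "(2 * t - 1)\<^sup>2 \<ge> 0" by simp
  ultimately have "2 * (t * (1 - t) ^ (p - 1)) \<le> 1"
    by (simp only: power2_eq_square) (simp add: algebra_simps)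
  moreover have "t * ((1 - t) ^ k - (1 - t) ^ (p - 1)) \<le> 1" for k
    using mult_left_mono[of "(1 - t) ^ k - (1 - t) ^ (p - 1)" "(1 - t) ^ k" t]
      pw(3)[of k] pw(1)[of "p - 1"] assms(2) by linarith
  ultimately have "nf_weight p t s \<le> 1"
    using pw(3) by (cases s) (simp_all add: mult.assoc mult.left_commute[of 2])
  moreover have "{u. length u = 0 \<and> nf_accepts p s u} = {[]}" by auto
  ultimately show ?case by simp
next
  case (Suc n)
  let ?N = "\<lambda>s. real (card {u. length u = n \<and> nf_accepts p s u})"
  have "nf_weight p t s * (1 / t) ^ Suc n =
    (\<Sum>l\<in>letters_below p. case nf_step p s l of None \<Rightarrow> 0 | Some s' \<Rightarrow> nf_weight p t s') * (1 / t) ^ n"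
    using assms(2) by (subst nf_weight_eigenvector[OF assms(1,4) Suc.prems]) simp
  also have "\<dots> = (\<Sum>l\<in>letters_below p. case nf_step p s l of None \<Rightarrow> 0
      | Some s' \<Rightarrow> nf_weight p t s' * (1 / t) ^ n)"
    unfolding sum_distrib_right by (intro sum.cong) (auto split: option.splits)
  also have "\<dots> \<le> (\<Sum>l\<in>letters_below p. case nf_step p s l of None \<Rightarrow> 0 | Some s' \<Rightarrow> ?N s')"
    using Suc.IH nf_valid_step[OF Suc.prems] by (intro sum_mono) (auto split: option.splits)
  also have "\<dots> = real (card {u. length u = Suc n \<and> nf_accepts p s u})"
    unfolding card_nf_accepts_Suc[OF order.strict_trans2[OF zero_less_numeral assms(1)]] of_nat_sum
    by (intro sum.cong) (auto split: option.splits)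
  finally show ?case .
qed

section \<open>From accepted words to balls in the group\<close>

lemma inv_presented_group_generator:
  "inv\<^bsub>presented_group R\<^esub> (pres_class R [Gen a]) = pres_class R [Inv a]"
proof (rule group.inv_equality[OF group_presented_group])
  show "pres_class R [Inv a] \<otimes>\<^bsub>presented_group R\<^esub> pres_class R [Gen a] = \<one>\<^bsub>presented_group R\<^esub>"
    using pres_cong.cancel_Inv_Gen[of R "[]" a "[]"]
    by (simp add: mult_presented_group one_presented_group pres_class_eq_iff)
qed (auto simp: carrier_presented_group)

lemma pres_class_word_length:
  assumes "set u \<subseteq> letters_below p" "p > 0"
  shows "word_length (thompson_group p) (thompson_gen p ` {0..p - 1}) (pres_class (thompson_rels p) u)
    \<le> enat (length u)"
proof -
  let ?R = "thompson_rels p"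
  have "foldr (mult (presented_group ?R)) (map (\<lambda>l. pres_class ?R [l]) u) \<one>\<^bsub>presented_group ?R\<^esub>
    = pres_class ?R u"
    by (induction u) (simp_all add: one_presented_group mult_presented_group)
  moreover have "pres_class ?R [l] \<in> thompson_gen p ` {0..p - 1} \<union>
      m_inv (presented_group ?R) ` thompson_gen p ` {0..p - 1}" if "l \<in> letters_below p" for l
    using that \<open>p > 0\<close>
    by (auto simp: letters_below_def thompson_gen_def image_image inv_presented_group_generator)
  ultimately show ?thesis
    using assms(1) unfolding word_length_le_iff thompson_group_def
    by (intro exI[of _ "map (\<lambda>l. pres_class ?R [l]) u"]) auto
qed

text \<open>Accepted words of length \<open>n\<close> represent elements of the ball, and distinct
  ones act differently on \<open>([], 0)\<close>.\<close>

lemma card_nf_accepts_le_growth: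
  assumes "p \<ge> 2" "nf_valid p s"
  shows "card {u. length u = n \<and> nf_accepts p s u}
    \<le> growth_function (thompson_group p) (thompson_gen p ` {0..p - 1}) n"
  unfolding growth_function_def
proof (rule card_inj_on_le)
  let ?W = "{u. length u = n \<and> nf_accepts p s u}"
  show "inj_on (pres_class (thompson_rels p)) ?W"
  proof (rule inj_onI)
    fix u v assume "u \<in> ?W" "v \<in> ?W" "pres_class (thompson_rels p) u = pres_class (thompson_rels p) v"
    then show "u = v"
      using word_act_cong[OF assms(1), of u v "([], 0)"] word_act_inject[OF assms]
      by (simp add: pres_class_eq_iff)
  qed
  show "pres_class (thompson_rels p) ` ?W \<subseteq> {g \<in> carrier (thompson_group p).
      word_length (thompson_group p) (thompson_gen p ` {0..p - 1}) g \<le> enat n}"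
    using assms(1) pres_class_word_length[of _ p] nf_accepts_letters[of p s]
    by (auto simp: thompson_group_def carrier_presented_group)
  show "finite {g \<in> carrier (thompson_group p).
      word_length (thompson_group p) (thompson_gen p ` {0..p - 1}) g \<le> enat n}"
    by (intro finite_ball)
       (auto simp: thompson_group_def group_presented_group carrier_presented_group thompson_gen_def)
qed

section \<open>The equation for \<open>\<xi>\<^sub>p\<close>\<close>

lemma xi_props:
  assumes "p \<ge> 2"
  shows "xi p > 1" "(2 * xi p - 1) * (xi p - 1) ^ (p - 1) = xi p ^ p"
  using theI'[OF ex1_xi[OF assms]] unfolding xi_def by blast+

text \<open>The logarithm of the quotient of the two sides of the equation for \<open>xi p\<close>;
  in terms of \<open>1 / x\<close> both summands visibly increase with \<open>x\<close>.\<close>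

definition xi_log :: "nat \<Rightarrow> real \<Rightarrow> real" where
  "xi_log p x = ln (2 - 1 / x) + (real p - 1) * ln (1 - 1 / x)"

lemma xi_log_xi:
  assumes "p \<ge> 2"
  shows "xi_log p (xi p) = 0"
proof -
  define x where "x = xi p"
  have x: "x > 1" "(2 * x - 1) * (x - 1) ^ (p - 1) = x ^ p"
    using xi_props[OF assms] by (simp_all add: x_def)
  have "ln (2 * x - 1) + (real p - 1) * ln (x - 1) = ln ((2 * x - 1) * (x - 1) ^ (p - 1))"
    using x(1) assms by (simp add: ln_mult ln_realpow of_nat_diff)
  also have "\<dots> = real p * ln x"
    using x by (simp add: ln_realpow)
  finally have eq: "ln (2 * x - 1) + (real p - 1) * ln (x - 1) = real p * ln x" .
  have ln_diff: "ln (2 - 1 / x) = ln (2 * x - 1) - ln x" "ln (1 - 1 / x) = ln (x - 1) - ln x"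
    using x(1) ln_div[of "2 * x - 1" x] ln_div[of "x - 1" x] by (simp_all add: diff_divide_distrib)
  have "xi_log p x = 0"
    using eq unfolding xi_log_def ln_diff by (simp add: algebra_simps)
  then show ?thesis by (simp add: x_def)
qed

lemma xi_log_strict_mono:
  assumes "p \<ge> 2" "1 < x" "x < y"
  shows "xi_log p x < xi_log p y"
proof -
  have "1 / y < 1 / x" "1 / x < 1" using assms by (auto simp: field_simps)
  then have "1 - 1 / x > 0" "1 - 1 / x < 1 - 1 / y" "2 - 1 / x > 0" "2 - 1 / x < 2 - 1 / y"
    by linarith+
  then show ?thesis
    using assms unfolding xi_log_def by (intro add_strict_mono mult_strict_left_mono) (auto simp: ln_less_cancel_iff simp del: diff_less_eq)
qed

text \<open>With \<open>u = 1 / x\<close>, \<open>xi_log p x\<close> is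
  \<open>ln 2 - (p - 1/2) u - p u^2 / 2\<close> up to \<open>O(p^-2)\<close>. The summand
  \<open>1/2\<close> in the argument cancels the quadratic term, which leaves
  \<open>(ln 2)^2 * \<epsilon> / p\<close>.\<close>

lemma xi_log_asymp:
  fixes \<epsilon> :: real
  shows "(\<lambda>p. real p * xi_log p ((real p - 1 / 2) / ln 2 + 1 / 2 + \<epsilon>)) \<longlonglongrightarrow> (ln 2)\<^sup>2 * \<epsilon>"
proof -
  have "ln 2 > (0::real)" by simp
  then show ?thesis unfolding xi_log_def by (real_asymp simp: field_simps power2_eq_square)
qed

text \<open>Opposite signs of the increasing function \<open>xi_log p\<close> at
  \<open>z p - \<epsilon>\<close> and \<open>z p + \<epsilon>\<close> trap its zero
  \<open>xi p\<close> between them.\<close>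

lemma xi_asymp: "(\<lambda>p. xi p - ((real p - 1 / 2) / ln 2 + 1 / 2)) \<in> o(\<lambda>_. 1)"
proof -
  define z where "z p = (real p - 1 / 2) / ln 2 + 1 / 2" for p :: nat
  have "eventually (\<lambda>p. dist (xi p - z p) 0 < \<epsilon>) sequentially" if "\<epsilon> > 0" for \<epsilon>
  proof -
    have "eventually (\<lambda>p. real p * xi_log p (z p + \<epsilon>) > 0) sequentially"
      using order_tendstoD(1)[OF xi_log_asymp[of \<epsilon>], of 0] that by (simp add: z_def)
    moreover have "eventually (\<lambda>p. real p * xi_log p (z p - \<epsilon>) < 0) sequentially"
      using order_tendstoD(2)[OF xi_log_asymp[of "-\<epsilon>"], of 0] that by (simp add: z_def)
    moreover have "eventually (\<lambda>p. z p - \<epsilon> > 1) sequentially"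
      unfolding z_def by real_asymp
    moreover have "eventually (\<lambda>p::nat. p \<ge> 2) sequentially" by real_asymp
    ultimately show ?thesis
    proof eventually_elim
      case (elim p)
      then have "xi_log p (z p + \<epsilon>) > 0" "xi_log p (z p - \<epsilon>) < 0"
        by (simp_all add: zero_less_mult_iff mult_less_0_iff)
      then have "xi p < z p + \<epsilon>" "z p - \<epsilon> < xi p"
        using xi_log_strict_mono[of p "z p + \<epsilon>" "xi p"] xi_log_strict_mono[of p "xi p" "z p - \<epsilon>"]
          xi_log_xi[of p] xi_props(1)[of p] elim that
        by (cases "xi p" "z p + \<epsilon>" rule: linorder_cases; cases "xi p" "z p - \<epsilon>" rule: linorder_cases; force)+
      then show ?case by (simp add: dist_real_def abs_less_iff)
    qed
  qed
  then have "(\<lambda>p. xi p - z p) \<longlonglongrightarrow> 0" by (intro tendstoI)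
  then show ?thesis unfolding z_def by (intro smalloI_tendsto) auto
qed

lemma growth_rate_thompson_ge:
  assumes "p \<ge> 2"
  shows "xi p \<le> growth_rate (thompson_group p) (thompson_gen p ` {0..p - 1})"
proof -
  define t where "t = 1 / xi p"
  have xi: "xi p > 1" "(2 * xi p - 1) * (xi p - 1) ^ (p - 1) = xi p ^ p"
    using xi_props[OF assms] .
  have t: "0 < t" "t < 1" using xi(1) by (auto simp: t_def)
  have "2 - t = (2 * xi p - 1) / xi p" "1 - t = (xi p - 1) / xi p"
    using xi(1) by (simp_all add: t_def field_simps)
  then have "(2 - t) * (1 - t) ^ (p - 1) = xi p ^ p / (xi p * xi p ^ (p - 1))"
    using xi(2) by (simp add: power_divide)
  also have "xi p * xi p ^ (p - 1) = xi p ^ p" using assms by (cases p) auto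
  finally have root: "(2 - t) * (1 - t) ^ (p - 1) = 1" using xi(1) by simp
  show ?thesis
  proof (rule growth_rate_ge)
    \<comment> \<open>The constant in the exponential lower bound is the weight of the start state
      \<open>Free\<close>.\<close>
    show "nf_weight p t Free > 0" using t by simp
    show "nf_weight p t Free * xi p ^ n
        \<le> real (growth_function (thompson_group p) (thompson_gen p ` {0..p - 1}) n)" for n
    proof -
      have "nf_weight p t Free * xi p ^ n \<le> real (card {u. length u = n \<and> nf_accepts p Free u})"
        using card_nf_accepts_ge[OF assms t root, of Free n] by (simp add: t_def)
      also have "\<dots> \<le> real (growth_function (thompson_group p) (thompson_gen p ` {0..p - 1}) n)"
        using card_nf_accepts_le_growth[OF assms, of Free n] by simp
      finally show ?thesis .
    qed
  qed (use xi(1) in \<open>auto simp: thompson_group_def group_presented_group carrier_presented_group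
         thompson_gen_def\<close>)
qed

theorem theorem6p1:
  "(\<forall>p\<ge>2. growth_rate (thompson_group p) (thompson_gen p ` {0..p - 1}) \<ge> xi p) \<and>
   (\<lambda>p. xi p - ((real p - 1 / 2) / ln 2 + 1 / 2)) \<in> o(\<lambda>_. 1)"
  using growth_rate_thompson_ge xi_asymp by blast

end
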